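(* Let $$F(z)=\left(\left(z-\tfrac1{50}\right)^2+\left(\tfrac7{25}\right)^2\right)\left(\left(z+\tfrac1{50}\right)^2+\left(\tfrac7{25}\right)^2\right)\left(\left(z-\tfrac35\right)^2+\left(\tfrac{11}{25}\right)^2\right)\left(\left(z+\tfrac35\right)^2+\left(\tfrac{11}{25}\right)^2\right),$$ and for real $\omega\ge 0$ let $$A_\omega(z)=\frac{F(z+i\omega)+F(z-i\omega)}{2},\qquad \Omega_F=\{\omega\ge 0 : A_\omega \text{ has only real zeros}\}.$$ Then the following hold. (1) The polynomial $F$ is real (has real coefficients) and even, and every complex zero $z$ of $F$ satisfies $|\operatorname{Im} z|\le \frac{11}{25}$. (2) $\frac{6}{25}\in\Omega_F$, $\frac{3}{10}\notin\Omega_F$, and $\frac{12}{25}\in\Omega_F$. Moreover, the number of distinct real zeros of $A_\omega$ is exactly $8$ for $\omega=\frac{6}{25}$, exactly $4$ for $\omega=\frac{3}{10}$, and exactly $8$ for $\omega=\frac{12}{25}$. (3) $\left[\frac{11}{25},\infty\right)\subset\Omega_F$. (4) Consequently, $\Omega_F$ is neither an up-set in $[0,\infty)$ nor an interval.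
   Context: Here $i$ is the imaginary unit, and $F$ and $A_\omega$ are regarded as polynomials in the complex variable $z$. "$A_\omega$ has only real zeros" means that every complex zero of $A_\omega$ is a real number. A subset $U\subset[0,\infty)$ is called an up-set if $\omega\in U$ and $\sigma>\omega$ imply $\sigma\in U$. *)

theory Defs
  imports "HOL-Analysis.Analysis" "HOL-Computational_Algebra.Polynomial"
begin

definition F_poly :: "complex poly" where
  "F_poly =
     ([:- (1/50), 1:]\<^sup>2 + [:(7/25)\<^sup>2:]) * ([:1/50, 1:]\<^sup>2 + [:(7/25)\<^sup>2:]) *
     ([:- (3/5), 1:]\<^sup>2 + [:(11/25)\<^sup>2:]) * ([:3/5, 1:]\<^sup>2 + [:(11/25)\<^sup>2:])"

definition A_poly :: "complex poly \<Rightarrow> real \<Rightarrow> complex poly" where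
  "A_poly P \<omega> =
     smult (1/2) (pcompose P [:\<i> * complex_of_real \<omega>, 1:] + pcompose P [:- \<i> * complex_of_real \<omega>, 1:])"

definition only_real_zeros :: "complex poly \<Rightarrow> bool" where
  "only_real_zeros P \<longleftrightarrow> (\<forall>z. poly P z = 0 \<longrightarrow> z \<in> \<real>)"

definition real_zeros :: "complex poly \<Rightarrow> real set" where
  "real_zeros P = {x. poly P (complex_of_real x) = 0}"

definition Omega :: "complex poly \<Rightarrow> real set" where
  "Omega P = {\<omega>. 0 \<le> \<omega> \<and> only_real_zeros (A_poly P \<omega>)}"

definition up_set :: "real set \<Rightarrow> bool" where
  "up_set U \<longleftrightarrow> U \<subseteq> {0..} \<and> (\<forall>\<omega> \<sigma>. \<omega> \<in> U \<longrightarrow> \<sigma> > \<omega> \<longrightarrow> \<sigma> \<in> U)"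

lemma poly_F_poly:
  "poly F_poly z =
     ((z - 1/50)\<^sup>2 + (7/25)\<^sup>2) * ((z + 1/50)\<^sup>2 + (7/25)\<^sup>2) *
     ((z - 3/5)\<^sup>2 + (11/25)\<^sup>2) * ((z + 3/5)\<^sup>2 + (11/25)\<^sup>2)"
  by (simp add: F_poly_def algebra_simps)

lemma poly_A_poly:
  "poly (A_poly P \<omega>) z =
     (poly P (z + \<i> * complex_of_real \<omega>) + poly P (z - \<i> * complex_of_real \<omega>)) / 2"
  by (simp add: A_poly_def poly_pcompose algebra_simps)

end

theory Submission
  imports Defs
begin

text \<open>
  The average \<open>A\<^sub>\<omega>\<close> of the even real polynomial \<open>F\<close> is again even and real, and clearing denominators
  by \<open>w = 50 z\<close>, \<open>t = 50 \<omega>\<close> turns it into a monic quartic with integer coefficients in \<open>u = w\<^sup>2\<close>.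
  For \<open>t = 12\<close> and \<open>t = 24\<close> this quartic has four sign changes on the positive half-line, hence eight real
  zeros \<open>z\<close>; for \<open>t = 15\<close> it splits into two positive linear factors and a quadratic factor of
  negative discriminant.
  For \<open>\<omega> \<ge> 11/25\<close> all zeros of \<open>F\<close> lie in the strip \<open>\<bar>Im z\<bar> \<le> \<omega>\<close>, and pairing the factors of conjugate
  zeros gives \<open>\<bar>F (z + i\<omega>)\<bar> > \<bar>F (z - i\<omega>)\<bar>\<close> in the upper half-plane, so the average cannot
  vanish there (the Hermite--Biehler argument).
\<close>

section \<open>Real coefficients, evenness and zeros of F\<close>

lemma coeff_mult_in_Reals:
  assumes "\<And>n. coeff p n \<in> \<real>" "\<And>n. coeff q n \<in> \<real>"
  shows "coeff (p * q) n \<in> \<real>"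
  unfolding coeff_mult using assms by (intro sum_in_Reals Reals_mult)

lemma coeff_pCons_in_Reals:
  assumes "a \<in> \<real>" "\<And>n. coeff p n \<in> \<real>"
  shows "coeff (pCons a p) n \<in> \<real>"
  using assms by (cases n) auto

lemma coeff_add_in_Reals:
  assumes "\<And>n. coeff p n \<in> \<real>" "\<And>n. coeff q n \<in> \<real>"
  shows "coeff (p + q) n \<in> \<real>"
  using assms by simp

lemma F_poly_real: "coeff F_poly n \<in> \<real>"
  unfolding F_poly_def power2_eq_square
  by (intro coeff_mult_in_Reals coeff_add_in_Reals coeff_pCons_in_Reals) auto

lemma F_poly_even: "poly F_poly (- z) = poly F_poly z"
proof -
  have "(- z - a)\<^sup>2 = (z + a)\<^sup>2" "(- z + a)\<^sup>2 = (z - a)\<^sup>2" for a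
    by (simp_all add: power2_eq_square algebra_simps)
  then show ?thesis
    unfolding poly_F_poly by simp
qed

lemma conjugate_pair_factor:
  "(z - of_real a)\<^sup>2 + (of_real b)\<^sup>2 = (z - Complex a b) * (z - Complex a (- b))"
  by (simp add: complex_eq_iff power2_eq_square algebra_simps)

lemma Im_zero_of_conjugate_pair:
  assumes "(z - of_real a)\<^sup>2 + (of_real b)\<^sup>2 = 0"
  shows "\<bar>Im z\<bar> = \<bar>b\<bar>"
proof -
  have "z = Complex a b \<or> z = Complex a (- b)"
    using assms unfolding conjugate_pair_factor mult_eq_0_iff by (simp only: right_minus_eq)
  then show ?thesis by auto
qed

lemma poly_F_poly_pairs:
  "poly F_poly z =
     ((z - of_real (1/50))\<^sup>2 + (of_real (7/25))\<^sup>2) * ((z - of_real (-1/50))\<^sup>2 + (of_real (7/25))\<^sup>2) *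
     ((z - of_real (3/5))\<^sup>2 + (of_real (11/25))\<^sup>2) * ((z - of_real (-3/5))\<^sup>2 + (of_real (11/25))\<^sup>2)"
  unfolding poly_F_poly by simp

lemma F_poly_zero_Im:
  assumes "poly F_poly z = 0"
  shows "\<bar>Im z\<bar> \<le> 11/25"
proof -
  have "\<bar>Im z\<bar> = \<bar>7/25\<bar> \<or> \<bar>Im z\<bar> = \<bar>11/25\<bar>"
    using assms unfolding poly_F_poly_pairs mult_eq_0_iff by (blast dest: Im_zero_of_conjugate_pair)
  then show ?thesis by auto
qed

section \<open>Zeros of the average for \<omega> at least 11/25\<close>

lemma norm_conjugate_pair_shift_less:
  assumes "0 < Im z" "0 < b" "b \<le> \<omega>"
  shows "norm ((z - \<i> * of_real \<omega> - of_real a)\<^sup>2 + (of_real b)\<^sup>2)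
       < norm ((z + \<i> * of_real \<omega> - of_real a)\<^sup>2 + (of_real b)\<^sup>2)"
proof -
  have cmod_le: "cmod v \<le> cmod w" if "Re v = Re w" "\<bar>Im v\<bar> \<le> \<bar>Im w\<bar>" for v w
    using that by (simp add: cmod_def abs_le_square_iff)
  have cmod_less: "cmod v < cmod w" if "Re v = Re w" "\<bar>Im v\<bar> < \<bar>Im w\<bar>" for v w
    using that by (simp add: cmod_def power2_strict_mono)
  \<comment> \<open>The factors are compared crosswise, so that real parts agree: Im z - (\<omega> +
    b) against Im z + (\<omega> + b), then Im z - (\<omega> - b) against Im z + (\<omega> - b). The
    second comparison uses b \<le> \<omega> and is an equality at b = \<omega>, so strictness comes
    from the first, multiplied by a nonzero factor.\<close>
  have "cmod (z - \<i> * of_real \<omega> - Complex a b) < cmod (z + \<i> * of_real \<omega> - Complex a (- b))"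
    using assms by (intro cmod_less) auto
  moreover have "cmod (z - \<i> * of_real \<omega> - Complex a (- b)) \<le> cmod (z + \<i> * of_real \<omega> - Complex a b)"
    using assms by (intro cmod_le) auto
  moreover have "0 < cmod (z + \<i> * of_real \<omega> - Complex a b)"
    using assms by (auto simp: complex_eq_iff)
  ultimately show ?thesis
    unfolding conjugate_pair_factor norm_mult
    by (metis mult.commute norm_ge_zero order.strict_trans1 mult_left_mono mult_strict_right_mono)
qed

lemma F_poly_norm_less:
  assumes "0 < Im z" "11/25 \<le> \<omega>"
  shows "norm (poly F_poly (z - \<i> * of_real \<omega>)) < norm (poly F_poly (z + \<i> * of_real \<omega>))"
  unfolding poly_F_poly_pairs norm_mult
  using assms
  by (intro mult_strict_mono' norm_conjugate_pair_shift_less mult_nonneg_nonneg norm_ge_zero) auto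

lemma Omega_F_poly_atLeast: "{11/25..} \<subseteq> Omega F_poly"
proof
  fix \<omega> :: real
  assume "\<omega> \<in> {11/25..}"
  then have \<omega>: "11/25 \<le> \<omega>" by simp
  have upper: "poly F_poly (z + \<i> * of_real \<omega>) + poly F_poly (z - \<i> * of_real \<omega>) \<noteq> 0" if "0 < Im z" for z
    using F_poly_norm_less[OF that \<omega>] by (metis add_eq_0_iff less_irrefl norm_minus_cancel)
  have "Im z = 0" if "poly (A_poly F_poly \<omega>) z = 0" for z
  proof (rule ccontr)
    assume "Im z \<noteq> 0"
    then consider "0 < Im z" | "0 < Im (- z)" by fastforce
    then show False
    proof cases
      case 1
      then show ?thesis using upper that by (simp add: poly_A_poly)
    next
      case 2
      \<comment> \<open>Negation swaps the two shifts up to sign, so by evenness -z is a zero of the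
        average as well, now in the upper half-plane.\<close>
      have "- z + \<i> * of_real \<omega> = - (z - \<i> * of_real \<omega>)" "- z - \<i> * of_real \<omega> = - (z + \<i> * of_real \<omega>)"
        by simp_all
      then show ?thesis
        using upper[OF 2] that by (simp only: F_poly_even poly_A_poly) (simp add: add.commute)
    qed
  qed
  then show "\<omega> \<in> Omega F_poly"
    using \<omega> by (auto simp: Omega_def only_real_zeros_def complex_is_Real_iff)
qed

section \<open>Reduction to a real quartic in the squared variable\<close>

definition A_quartic :: "real \<Rightarrow> real poly" where
  "A_quartic t =
     [:t^8 + 442 * t^6 + 1629785 * t^4 - 714738752 * t\<^sup>2 + 74336931904,
       - 28 * t^6 - 6630 * t^4 - 9778710 * t\<^sup>2 + 714738752,
       70 * t^4 + 6630 * t\<^sup>2 + 1629785,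
       - 28 * t\<^sup>2 - 442,
       1:]"

lemma poly_F_poly_scaled:
  "50 ^ 8 * poly F_poly v =
     (50 * v)^8 - 442 * (50 * v)^6 + 1629785 * (50 * v)^4 + 714738752 * (50 * v)\<^sup>2 + 74336931904"
  unfolding poly_F_poly
  by (simp add: field_simps) algebra

lemma poly_A_poly_F_poly:
  "50 ^ 8 * poly (A_poly F_poly \<omega>) z =
     poly (map_poly of_real (A_quartic (50 * \<omega>))) ((50 * z)\<^sup>2)"
proof -
  \<comment> \<open>With G(w) = 50^8 F(w/50), Taylor expansion at \<plusminus>jt cancels the odd
    powers of w because G is even. The coefficient of w^(2k) that survives is G^(2k)(jt)/(2k)!,
    which is where the entries of \<open>A_quartic\<close> come from.\<close>
  have even_part:
    "(w + j * t)^8 - 442 * (w + j * t)^6 + 1629785 * (w + j * t)^4 + 714738752 * (w + j * t)\<^sup>2 + 74336931904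
     + ((w - j * t)^8 - 442 * (w - j * t)^6 + 1629785 * (w - j * t)^4 + 714738752 * (w - j * t)\<^sup>2 + 74336931904)
     = 2 * ((t^8 + 442 * t^6 + 1629785 * t^4 - 714738752 * t\<^sup>2 + 74336931904)
       + w\<^sup>2 * ((- 28 * t^6 - 6630 * t^4 - 9778710 * t\<^sup>2 + 714738752)
       + w\<^sup>2 * ((70 * t^4 + 6630 * t\<^sup>2 + 1629785)
       + w\<^sup>2 * ((- 28 * t\<^sup>2 - 442) + w\<^sup>2))))"
    if "j\<^sup>2 = -1" for w j t :: complex
    using that by algebra
  define w t where "w = 50 * z" and "t = complex_of_real (50 * \<omega>)"
  have shift: "50 * (z + \<i> * of_real \<omega>) = w + \<i> * t" "50 * (z - \<i> * of_real \<omega>) = w - \<i> * t"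
    by (simp_all add: w_def t_def algebra_simps)
  have "50 ^ 8 * poly (A_poly F_poly \<omega>) z =
      (50 ^ 8 * poly F_poly (z + \<i> * of_real \<omega>) + 50 ^ 8 * poly F_poly (z - \<i> * of_real \<omega>)) / 2"
    by (simp add: poly_A_poly)
  also have "\<dots> = (t^8 + 442 * t^6 + 1629785 * t^4 - 714738752 * t\<^sup>2 + 74336931904)
       + w\<^sup>2 * ((- 28 * t^6 - 6630 * t^4 - 9778710 * t\<^sup>2 + 714738752)
       + w\<^sup>2 * ((70 * t^4 + 6630 * t\<^sup>2 + 1629785)
       + w\<^sup>2 * ((- 28 * t\<^sup>2 - 442) + w\<^sup>2)))"
    unfolding poly_F_poly_scaled shift even_part[OF power2_i] by simp
  also have "\<dots> = poly (map_poly of_real (A_quartic (50 * \<omega>))) (w\<^sup>2)"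
    by (simp add: A_quartic_def map_poly_pCons t_def)
  finally show ?thesis unfolding w_def .
qed

section \<open>Counting real zeros through the roots of the quartic\<close>

lemma real_zeros_A_poly:
  "real_zeros (A_poly F_poly \<omega>) = {x. (50 * x)\<^sup>2 \<in> {u. poly (A_quartic (50 * \<omega>)) u = 0}}"
proof -
  have "poly (A_poly F_poly \<omega>) (of_real x) = 0 \<longleftrightarrow> poly (A_quartic (50 * \<omega>)) ((50 * x)\<^sup>2) = 0" for x :: real
  proof -
    have "50 ^ 8 * poly (A_poly F_poly \<omega>) (of_real x) =
        complex_of_real (poly (A_quartic (50 * \<omega>)) ((50 * x)\<^sup>2))"
      unfolding poly_A_poly_F_poly by (simp add: A_quartic_def map_poly_pCons)
    then show ?thesis
      by (metis mult_eq_0_iff of_real_eq_0_iff power_not_zero zero_neq_numeral)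
  qed
  then show ?thesis by (simp add: real_zeros_def)
qed

text \<open>Each u has the two preimages \<plusminus>sqrt u / c; positivity of u keeps them
  distinct.\<close>

lemma card_scaled_square_vimage:
  fixes U :: "real set"
  assumes "finite U" "\<And>u. u \<in> U \<Longrightarrow> 0 < u" "0 < c"
  shows "card {x. (c * x)\<^sup>2 \<in> U} = 2 * card U"
proof -
  let ?f = "\<lambda>u. sqrt u / c" and ?g = "\<lambda>u. - (sqrt u / c)"
  have "{x. (c * x)\<^sup>2 \<in> U} = ?f ` U \<union> ?g ` U"
  proof (intro equalityI subsetI)
    fix x assume "x \<in> {x. (c * x)\<^sup>2 \<in> U}"
    moreover have "x = ?f ((c * x)\<^sup>2) \<or> x = ?g ((c * x)\<^sup>2)"
      using \<open>0 < c\<close> by (auto simp: abs_mult abs_if)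
    ultimately show "x \<in> ?f ` U \<union> ?g ` U" by blast
  next
    fix x assume "x \<in> ?f ` U \<union> ?g ` U"
    then show "x \<in> {x. (c * x)\<^sup>2 \<in> U}"
      using assms by (auto simp: less_imp_le)
  qed
  moreover have "?f ` U \<inter> ?g ` U = {}"
  proof -
    have "?g v < ?f u" if "u \<in> U" "v \<in> U" for u v
    proof -
      have "0 < ?f u" "0 < ?f v" using that assms by simp_all
      then show ?thesis by linarith
    qed
    then show ?thesis by fastforce
  qed
  moreover have "inj_on ?f U" "inj_on ?g U"
    using \<open>0 < c\<close> by (auto intro!: inj_onI)
  ultimately show ?thesis
    using assms(1) by (simp add: card_Un_disjoint card_image)
qed

lemma poly_root_between:
  fixes p :: "real poly"
  assumes "a < b" "poly p a * poly p b < 0"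
  obtains x where "a < x" "x < b" "poly p x = 0"
  using poly_IVT[OF assms] by blast

text \<open>The intermediate value theorem gives one root in each of four disjoint intervals to the
  right of 0, and the degree leaves room for no others.\<close>

lemma card_positive_roots_quartic:
  fixes p :: "real poly"
  assumes deg: "degree p = 4"
    and "0 \<le> a" "a < b" "b < c" "c < d" "d < e"
    and "poly p a * poly p b < 0" "poly p b * poly p c < 0" "poly p c * poly p d < 0" "poly p d * poly p e < 0"
  shows "finite {u. poly p u = 0}" "card {u. poly p u = 0} = 4" "\<And>u. poly p u = 0 \<Longrightarrow> 0 < u"
proof -
  have p: "p \<noteq> 0" using deg by auto
  then show fin: "finite {u. poly p u = 0}" by (rule poly_roots_finite)
  obtain u1 where u1: "a < u1" "u1 < b" "poly p u1 = 0" using poly_root_between assms by metis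
  obtain u2 where u2: "b < u2" "u2 < c" "poly p u2 = 0" using poly_root_between assms by metis
  obtain u3 where u3: "c < u3" "u3 < d" "poly p u3 = 0" using poly_root_between assms by metis
  obtain u4 where u4: "d < u4" "u4 < e" "poly p u4 = 0" using poly_root_between assms by metis
  let ?U = "{u1, u2, u3, u4}"
  have sub: "?U \<subseteq> {u. poly p u = 0}" using u1 u2 u3 u4 by simp
  have card: "card ?U = 4" using u1 u2 u3 u4 by simp
  have le: "card {u. poly p u = 0} \<le> 4" using card_poly_roots_bound[OF p] deg by simp
  have eq: "?U = {u. poly p u = 0}"
    using card_seteq[OF fin sub] card le by simp
  then show "card {u. poly p u = 0} = 4" using card by simp
  fix u assume "poly p u = 0"
  then have "u \<in> ?U" using eq by simp
  then show "0 < u" using u1 u2 u3 u4 assms by auto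
qed

section \<open>The parameters 6/25 and 12/25\<close>

lemma degree_A_quartic: "degree (A_quartic t) = 4"
  by (simp add: A_quartic_def)

lemma card_real_zeros_A_poly:
  assumes "\<And>u. poly (A_quartic (50 * \<omega>)) u = 0 \<Longrightarrow> 0 < u"
  shows "card (real_zeros (A_poly F_poly \<omega>)) = 2 * card {u. poly (A_quartic (50 * \<omega>)) u = 0}"
proof -
  have "A_quartic (50 * \<omega>) \<noteq> 0" by (simp add: A_quartic_def)
  then show ?thesis
    unfolding real_zeros_A_poly using assms
    by (intro card_scaled_square_vimage poly_roots_finite) auto
qed

lemma card_real_zeros_6_25: "card (real_zeros (A_poly F_poly (6/25))) = 8"
proof -
  \<comment> \<open>Here t = 50 * 6/25 = 12. The sample points are u = (50 z)^2 for z = 0, 1/5, 2/5,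
    1, 6/5, where the signs alternate, starting with plus.\<close>
  note roots = card_positive_roots_quartic
    [OF degree_A_quartic[of 12], of 0 100 400 2500 3600, simplified A_quartic_def, simplified]
  show ?thesis
    using card_real_zeros_A_poly[of "6/25"] roots by (simp add: A_quartic_def)
qed

lemma card_real_zeros_12_25: "card (real_zeros (A_poly F_poly (12/25))) = 8"
proof -
  \<comment> \<open>The same alternation for t = 24, sampled at z = 0, 1/5, 3/5, 1, 4.\<close>
  note roots = card_positive_roots_quartic
    [OF degree_A_quartic[of 24], of 0 100 900 2500 40000, simplified A_quartic_def, simplified]
  show ?thesis
    using card_real_zeros_A_poly[of "12/25"] roots by (simp add: A_quartic_def)
qed

lemma degree_F_poly_le: "degree F_poly \<le> 8"
  by (simp add: F_poly_def power2_eq_square)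

lemma degree_A_poly_le: "degree (A_poly P \<omega>) \<le> degree P"
  unfolding A_poly_def
  by (intro order.trans[OF degree_smult_le] degree_add_le) (simp_all add: degree_pcompose)

text \<open>Real zeros that already exhaust the degree leave no room for nonreal ones. The second
  hypothesis excludes P = 0, whose infinite set of real zeros has \<open>card\<close> 0.\<close>

lemma only_real_zeros_if_card:
  assumes "degree P \<le> card (real_zeros P)" "card (real_zeros P) \<noteq> 0"
  shows "only_real_zeros P"
proof -
  let ?Z = "{z. poly P z = 0}"
  have P: "P \<noteq> 0"
  proof
    assume "P = 0"
    then have "real_zeros P = UNIV" by (simp add: real_zeros_def)
    then show False using assms(2) by (simp add: infinite_UNIV_char_0)
  qed
  then have fin: "finite ?Z" by (rule poly_roots_finite)
  have sub: "of_real ` real_zeros P \<subseteq> ?Z" by (auto simp: real_zeros_def)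
  have "card ?Z \<le> card (of_real ` real_zeros P :: complex set)"
    using card_poly_roots_bound[OF P] assms(1) by (simp add: card_image inj_on_def)
  then have "of_real ` real_zeros P = ?Z" using card_seteq[OF fin sub] by blast
  then show ?thesis unfolding only_real_zeros_def by (auto simp: set_eq_iff Reals_def)
qed

lemma Omega_6_25: "6/25 \<in> Omega F_poly"
proof -
  have "only_real_zeros (A_poly F_poly (6/25))"
    using degree_A_poly_le[of F_poly "6/25"] degree_F_poly_le card_real_zeros_6_25
    by (intro only_real_zeros_if_card) auto
  then show ?thesis by (simp add: Omega_def)
qed

section \<open>The parameter 3/10\<close>

lemma A_quartic_15_factor:
  obtains a b p r where "1 < a" "a < b" "p\<^sup>2 < 4 * r"
    "A_quartic 15 = [:- a, 1:] * [:- b, 1:] * [:r, p, 1:]"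
proof -
  let ?Q = "A_quartic 15"
  obtain a where a: "1 < a" "a < 2" "poly ?Q a = 0"
    by (rule poly_root_between[of 1 2 ?Q]) (simp_all add: A_quartic_def)
  obtain b where b: "5624 < b" "b < 5625" "poly ?Q b = 0"
    by (rule poly_root_between[of 5624 5625 ?Q]) (simp_all add: A_quartic_def)
  \<comment> \<open>Comparing the coefficients of u^3 and u^2 forces these values of p and
    r.\<close>
  define p where "p = a + b - 6742"
  define r where "r = 6665285 + (a + b) * p - a * b"
  have qa: "3626125204 - 2140052248 * a + 6665285 * a^2 - 6742 * a^3 + a^4 = 0"
    using a(3) by (simp add: A_quartic_def power_numeral_reduce algebra_simps)
  have qb: "3626125204 - 2140052248 * b + 6665285 * b^2 - 6742 * b^3 + b^4 = 0"
    using b(3) by (simp add: A_quartic_def power_numeral_reduce algebra_simps)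
  \<comment> \<open>The quartic minus the proposed product is now linear in u and vanishes at a and
    b. Subtracting its two values shows that the slope is 0; the constant term then follows from the
    root a.\<close>
  have "(b - a) * (a * b * p - (a + b) * r + 2140052248) = 0"
    using qa qb unfolding r_def p_def by algebra
  then have c1: "a * b * p - (a + b) * r = - 2140052248"
    using a b by auto
  have c0: "a * b * r = 3626125204"
    using c1 qa unfolding r_def p_def by algebra
  have c2: "r - (a + b) * p + a * b = 6665285" and c3: "p - (a + b) = - 6742"
    by (simp_all add: r_def p_def)
  have "?Q = [:- a, 1:] * [:- b, 1:] * [:r, p, 1:]"
    using c0 c1 c2 c3 by (simp add: A_quartic_def algebra_simps)
  moreover have "p\<^sup>2 < 4 * r"
  proof -
    \<comment> \<open>The isolating intervals are narrow enough to decide the discriminant: r is at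
      least 6665285 - 5627 * 1117 - 2 * 5625 = 368676, and 4 * 368676 exceeds 1117^2.\<close>
    have p: "- 1117 < p" "p < - 1115" using a b by (simp_all add: p_def)
    have "(- p)\<^sup>2 \<le> 1117\<^sup>2" using p by (intro power_mono) auto
    moreover have "(a + b) * (- p) \<le> 5627 * 1117" using a b p by (intro mult_mono) auto
    moreover have "a * b \<le> 2 * 5625" using a b by (intro mult_mono) auto
    ultimately show ?thesis by (simp add: r_def)
  qed
  moreover have "1 < a" "a < b" using a b by simp_all
  ultimately show thesis by (intro that)
qed

lemma quadratic_no_real_root:
  fixes p r u :: real
  assumes "p\<^sup>2 < 4 * r"
  shows "r + u * (p + u) \<noteq> 0"
proof -
  have "r + u * (p + u) = (u + p / 2)\<^sup>2 + (4 * r - p\<^sup>2) / 4"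
    by (simp add: power2_eq_square field_simps)
  also have "\<dots> > 0" using assms by (simp add: add_nonneg_pos)
  finally show ?thesis by simp
qed

lemma card_real_zeros_3_10: "card (real_zeros (A_poly F_poly (3/10))) = 4"
proof -
  obtain a b p r where f: "1 < a" "a < b" "p\<^sup>2 < 4 * r"
    "A_quartic 15 = [:- a, 1:] * [:- b, 1:] * [:r, p, 1:]"
    by (rule A_quartic_15_factor)
  have roots: "poly (A_quartic 15) u = 0 \<longleftrightarrow> u = a \<or> u = b" for u
    using quadratic_no_real_root[OF f(3), of u] unfolding f(4) poly_mult mult_eq_0_iff by auto
  then have "{u. poly (A_quartic 15) u = 0} = {a, b}" by auto
  moreover have "0 < u" if "poly (A_quartic 15) u = 0" for u
    using that f(1,2) unfolding roots by auto
  ultimately have "card (real_zeros (A_poly F_poly (3/10))) = 2 * card {a, b}"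
    using card_real_zeros_A_poly[of "3/10"] by simp
  then show ?thesis using f(2) by simp
qed

lemma not_Omega_3_10: "3/10 \<notin> Omega F_poly"
proof -
  obtain a b p r where f: "p\<^sup>2 < 4 * r"
    "A_quartic 15 = [:- a, 1:] * [:- b, 1:] * [:r, p, 1:]"
    by (rule A_quartic_15_factor)
  \<comment> \<open>The root of the quadratic factor with positive imaginary part;
    \<open>csqrt u / 50\<close> below undoes u = (50 z)^2, and it cannot be real since its scaled
    square u is not.\<close>
  define u where "u = Complex (- p / 2) (sqrt (4 * r - p\<^sup>2) / 2)"
  have u0: "of_real r + u * (of_real p + u) = 0"
    using f(1) by (simp add: u_def complex_eq_iff field_simps power2_eq_square)
  have "A_quartic 15 = [:- a, 1:] * ([:- b, 1:] * [:r, p, 1:])"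
    using f(2) by (simp only: mult.assoc)
  then have "poly (map_poly of_real (A_quartic 15)) u = (u - of_real a) * (u - of_real b) * (of_real r + u * (of_real p + u))"
    by (simp add: map_poly_pCons algebra_simps)
  with u0 have "poly (A_poly F_poly (3/10)) (csqrt u / 50) = 0"
    using poly_A_poly_F_poly[of "3/10" "csqrt u / 50"] by simp
  moreover have "csqrt u / 50 \<notin> \<real>"
  proof
    assume "csqrt u / 50 \<in> \<real>"
    then have "(50 * (csqrt u / 50))\<^sup>2 \<in> \<real>"
      by (intro Reals_power Reals_mult) auto
    then have "u \<in> \<real>" by simp
    then show False using f(1) by (simp add: u_def complex_is_Real_iff)
  qed
  ultimately show ?thesis
    unfolding Omega_def only_real_zeros_def by blast
qed

section \<open>The gap at 3/10 between members 6/25 and 12/25\<close>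

lemma not_up_set_Omega: "\<not> up_set (Omega F_poly)"
proof
  assume "up_set (Omega F_poly)"
  then have "3/10 \<in> Omega F_poly"
    using Omega_6_25 unfolding up_set_def by force
  then show False using not_Omega_3_10 by simp
qed

lemma not_is_interval_Omega: "\<not> is_interval (Omega F_poly)"
proof
  assume "is_interval (Omega F_poly)"
  moreover have "12/25 \<in> Omega F_poly" using Omega_F_poly_atLeast by auto
  ultimately have "3/10 \<in> Omega F_poly"
    using Omega_6_25 unfolding is_interval_1
    by (elim ballE[of _ _ "6/25"] ballE[of _ _ "12/25"]) auto
  then show False using not_Omega_3_10 by simp
qed

theorem theorem2p1:
  shows "((\<forall>n. coeff F_poly n \<in> \<real>) \<and>
          (\<forall>z. poly F_poly (- z) = poly F_poly z) \<and>
          (\<forall>z. poly F_poly z = 0 \<longrightarrow> \<bar>Im z\<bar> \<le> 11/25)) \<and>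
         (6/25 \<in> Omega F_poly \<and> 3/10 \<notin> Omega F_poly \<and> 12/25 \<in> Omega F_poly \<and>
          card (real_zeros (A_poly F_poly (6/25))) = 8 \<and>
          card (real_zeros (A_poly F_poly (3/10))) = 4 \<and>
          card (real_zeros (A_poly F_poly (12/25))) = 8) \<and>
         {11/25..} \<subseteq> Omega F_poly \<and>
         (\<not> up_set (Omega F_poly) \<and> \<not> is_interval (Omega F_poly))"
proof -
  have "12/25 \<in> Omega F_poly" using Omega_F_poly_atLeast by auto
  then show ?thesis
    using F_poly_real F_poly_even F_poly_zero_Im Omega_6_25 not_Omega_3_10 card_real_zeros_6_25
      card_real_zeros_3_10 card_real_zeros_12_25 Omega_F_poly_atLeast not_up_set_Omega
      not_is_interval_Omega
    by blast
qed

end
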